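(* Let $a,b$ be complex numbers, let $(\alpha_n(ab/q),\beta_n(ab/q))_{n\ge0}$ be a Bailey pair relative to the parameter $ab/q$, and let $$L(x,y)=(q,x,y;q)_\infty\sum_{n=0}^\infty\frac{(xy/q^2;q)_{2n}}{(q,x,y,xy/q^2;q)_n}\,q^n .$$ Then, provided all sums converge, $$\sum_{n=0}^\infty L(aq^{n+1},bq^{n+1})\,q^n\,\alpha_n(ab/q)=(q,aq,bq;q)_\infty\sum_{n=0}^\infty\frac{(ab;q)_{2n}}{(aq,bq;q)_n}\,q^n\,\beta_n(ab/q).$$
   Context: Here $q$ is a fixed complex number with $0<|q|<1$, and parameters are assumed to be such that no denominator vanishes. Notation: $(x;q)_\infty=\prod_{n\ge0}(1-xq^n)$, $(x;q)_n=(x;q)_\infty/(xq^n;q)_\infty$, and $(a_1,\ldots,a_m;q)_n=(a_1;q)_n\cdots(a_m;q)_n$ for $n$ an integer or $\infty$. A pair of complex sequences $(\alpha_n(t),\beta_n(t))_{n\ge0}$ is a Bailey pair relative to the parameter $t$ if for all $n\ge 0$, $\beta_n(t)=\sum_{k=0}^n\frac{\alpha_k(t)}{(q;q)_{n-k}(tq;q)_{n+k}}$. *)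

theory Defs
  imports "HOL-Analysis.Analysis"
begin

definition qpoch_inf :: "complex \<Rightarrow> complex \<Rightarrow> complex" where
  "qpoch_inf x q = (\<Prod>n. 1 - x * q ^ n)"

(* This quotient has the value of the usual finite product only if (x q^n; q)_infinity is
   nonzero, i.e. x q^(n+j) is not 1 for all natural j; otherwise it is 0 by division by zero. *)
definition qpoch :: "complex \<Rightarrow> complex \<Rightarrow> int \<Rightarrow> complex" where
  "qpoch x q n = qpoch_inf x q / qpoch_inf (x * q powi n) q"

(* The multi-parameter symbols (a_1, ..., a_m; q)_infinity and (a_1, ..., a_m; q)_n. *)
definition qpochs_inf :: "complex list \<Rightarrow> complex \<Rightarrow> complex" where
  "qpochs_inf xs q = (\<Prod>x\<leftarrow>xs. qpoch_inf x q)"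

definition qpochs :: "complex list \<Rightarrow> complex \<Rightarrow> int \<Rightarrow> complex" where
  "qpochs xs q n = (\<Prod>x\<leftarrow>xs. qpoch x q n)"

definition bailey_pair ::
    "complex \<Rightarrow> complex \<Rightarrow> (nat \<Rightarrow> complex) \<Rightarrow> (nat \<Rightarrow> complex) \<Rightarrow> bool" where
  "bailey_pair q t \<alpha> \<beta> \<longleftrightarrow>
     (\<forall>n. \<beta> n = (\<Sum>k=0..n. \<alpha> k / (qpoch q q (int n - int k) * qpoch (t * q) q (int n + int k))))"

definition L_term :: "complex \<Rightarrow> complex \<Rightarrow> complex \<Rightarrow> nat \<Rightarrow> complex" where
  "L_term q x y n =
     qpoch (x * y / q\<^sup>2) q (2 * int n) / qpochs [q, x, y, x * y / q\<^sup>2] q (int n) * q ^ n"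

definition L :: "complex \<Rightarrow> complex \<Rightarrow> complex \<Rightarrow> complex" where
  "L q x y = qpochs_inf [q, x, y] q * (\<Sum>n. L_term q x y n)"

end

theory Submission
  imports Defs
begin

text \<open>
  Substituting the definition of \<open>\<beta> n\<close> into the right-hand side gives a sum over pairs \<open>k \<le> n\<close>.
  Summed over \<open>n = m + k\<close> for fixed \<open>k\<close>, the splitting rule \<open>(x; q)\<^bsub>m+k\<^esub> = (x; q)\<^bsub>k\<^esub> (x q^k; q)\<^bsub>m\<^esub>\<close>
  turns the coefficient of \<open>\<alpha> k\<close> into \<open>q ^ k * L q (a * q ^ (k + 1)) (b * q ^ (k + 1))\<close>, up to the
  prefactor \<open>(q, aq, bq; q)\<^sub>\<infinity>\<close> (lemmas \<open>bailey_term_eq_kernel_sum\<close> and \<open>L_eq_kernel_sum\<close>). So the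
  identity is an interchange of summations.

  The series are only assumed to converge conditionally, so the interchange needs an argument.
  The weight of \<open>q ^ k * \<alpha> k\<close> in the \<open>n\<close>-th term is at most a constant times \<open>\<bar>q\<bar> ^ (n - k)\<close>, because
  every factorial occurring in it converges to a nonzero product. With such weights the interchange is
  legitimate as soon as \<open>q ^ k * \<alpha> k\<close> tends to zero and the row sums form a convergent series
  (\<open>triangular_sum_swap\<close>). The null sequence comes from the left-hand side: its terms tend to zero,
  and the factor \<open>L q (a * q ^ (k + 1)) (b * q ^ (k + 1))\<close> tends to \<open>1\<close> (\<open>L_tendsto_1\<close>), by dominated
  convergence and Euler's series \<open>\<Sum>m. q ^ m / (q; q)\<^sub>m = 1 / (q; q)\<^sub>\<infinity>\<close>.
\<close>

section \<open>Finite and infinite q-shifted factorials\<close>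

definition qprod :: "complex \<Rightarrow> complex \<Rightarrow> nat \<Rightarrow> complex" where
  "qprod x q n = (\<Prod>i<n. 1 - x * q ^ i)"

lemma qprod_0 [simp]: "qprod x q 0 = 1"
  by (simp add: qprod_def)

lemma qprod_Suc: "qprod x q (Suc n) = qprod x q n * (1 - x * q ^ n)"
  by (simp add: qprod_def)

lemma qprod_add: "qprod x q (m + n) = qprod x q m * qprod (x * q ^ m) q n"
  by (induction n) (simp_all add: qprod_Suc power_add mult_ac)

lemma qprod_nonzero: "(\<And>i. x * q ^ i \<noteq> 1) \<Longrightarrow> qprod x q n \<noteq> 0"
  by (simp add: qprod_def)

lemma convergent_prod_q_factors:
  fixes q :: complex
  assumes "norm q < 1"
  shows "convergent_prod (\<lambda>n. 1 - x * q ^ n)"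
proof -
  have "summable (\<lambda>n. norm x * norm q ^ n)"
    using assms by (intro summable_mult summable_geometric) auto
  then have "abs_convergent_prod (\<lambda>n. 1 - x * q ^ n)"
    by (simp add: abs_convergent_prod_conv_summable norm_mult norm_power)
  then show ?thesis
    by (rule abs_convergent_prod_imp_convergent_prod)
qed

lemma qprod_tendsto:
  assumes "norm q < 1"
  shows "qprod x q \<longlonglongrightarrow> qpoch_inf x q"
proof -
  have "(\<lambda>n. \<Prod>i\<le>n. 1 - x * q ^ i) \<longlonglongrightarrow> qpoch_inf x q"
    using convergent_prod_LIMSEQ[OF convergent_prod_q_factors[OF assms]]
    by (simp add: qpoch_inf_def)
  then have "(\<lambda>n. qprod x q (Suc n)) \<longlonglongrightarrow> qpoch_inf x q"
    by (simp add: qprod_def lessThan_Suc_atMost)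
  then show ?thesis
    by (rule LIMSEQ_imp_Suc)
qed

lemma qpoch_inf_nonzero:
  assumes "norm q < 1" "\<And>i. x * q ^ i \<noteq> 1"
  shows "qpoch_inf x q \<noteq> 0"
  unfolding qpoch_inf_def
  using assms by (intro prodinf_nonzero convergent_prod_q_factors) auto

lemma qpoch_inf_split:
  assumes "norm q < 1"
  shows "qpoch_inf x q = qprod x q n * qpoch_inf (x * q ^ n) q"
proof -
  have "(\<lambda>m. qprod x q (n + m)) \<longlonglongrightarrow> qpoch_inf x q"
    using LIMSEQ_ignore_initial_segment[OF qprod_tendsto[OF assms], of x n]
    by (simp add: add.commute)
  moreover have "(\<lambda>m. qprod x q (n + m)) \<longlonglongrightarrow> qprod x q n * qpoch_inf (x * q ^ n) q"
    unfolding qprod_add by (intro tendsto_intros qprod_tendsto assms)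
  ultimately show ?thesis
    by (rule LIMSEQ_unique)
qed

lemma qpoch_eq_qprod:
  assumes "norm q < 1" "\<And>i. x * q ^ i \<noteq> 1"
  shows "qpoch x q (int n) = qprod x q n"
proof -
  have "x * q ^ n * q ^ i \<noteq> 1" for i
    using assms(2)[of "n + i"] by (simp add: power_add mult.assoc)
  then have "qpoch_inf (x * q ^ n) q \<noteq> 0"
    by (intro qpoch_inf_nonzero assms) auto
  then show ?thesis
    using qpoch_inf_split[OF assms(1), of x n] by (simp add: qpoch_def)
qed

lemma qprod_bounded:
  assumes "norm q < 1" "\<And>i. x * q ^ i \<noteq> 1"
  obtains B where "B > 0" "\<And>n. norm (qprod x q n) \<le> B" "\<And>n. norm (inverse (qprod x q n)) \<le> B"
proof -
  have "Bseq (qprod x q)"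
    using qprod_tendsto[OF assms(1)] by (intro convergent_imp_Bseq convergentI)
  then obtain B1 where B1: "B1 > 0" "\<And>n. norm (qprod x q n) \<le> B1"
    by (auto elim: BseqE)
  have "Bseq (\<lambda>n. inverse (qprod x q n))"
    using tendsto_inverse[OF qprod_tendsto[OF assms(1)] qpoch_inf_nonzero[OF assms]]
    by (intro convergent_imp_Bseq convergentI)
  then obtain B2 where B2: "B2 > 0" "\<And>n. norm (inverse (qprod x q n)) \<le> B2"
    by (auto elim: BseqE)
  show ?thesis
    by (rule that[of "max B1 B2"]) (use B1 B2 in \<open>auto simp: le_max_iff_disj\<close>)
qed

lemma power_neq_1:
  fixes q :: complex
  assumes "norm q < 1"
  shows "q * q ^ i \<noteq> 1"
proof
  assume "q * q ^ i = 1"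
  then have "norm q ^ Suc i = 1"
    by (metis norm_one norm_power power_Suc)
  moreover have "norm q ^ Suc i < 1"
    using assms by (intro power_less_one_iff[THEN iffD2]) auto
  ultimately show False
    by simp
qed

text \<open>
  Euler's series for \<open>1 / (z; q)\<^sub>\<infinity>\<close> telescopes at \<open>z = q\<close>: its partial sums are the numbers \<open>1 / (q; q)\<^sub>M\<close>.
\<close>

lemma euler_sum:
  assumes "norm q < 1"
  shows "(\<lambda>m. q ^ m / qprod q q m) sums (1 / qpoch_inf q q)"
proof -
  have nz: "qprod q q m \<noteq> 0" for m
    using power_neq_1[OF assms] by (rule qprod_nonzero)
  have "(\<Sum>m\<le>M. q ^ m / qprod q q m) = 1 / qprod q q M" for M
  proof (induction M)
    case (Suc M)
    have "1 - q * q ^ M \<noteq> 0"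
      using power_neq_1[OF assms, of M] by auto
    then show ?case
      using Suc nz[of M] by (simp add: qprod_Suc field_simps)
  qed simp
  moreover have "(\<lambda>M. 1 / qprod q q M) \<longlonglongrightarrow> 1 / qpoch_inf q q"
    by (intro tendsto_intros qprod_tendsto qpoch_inf_nonzero power_neq_1 assms)
  ultimately show ?thesis
    by (simp add: sums_def_le)
qed

section \<open>Interchanging a conditionally convergent triangular double sum\<close>

text \<open>
  Absolute convergence of the double series is not available, since \<open>A\<close> need not be
  absolutely summable. What makes the interchange work is that the partial sums over \<open>n < N\<close> and
  over \<open>k < N\<close> differ by \<open>\<Sum>k<N. A k * t\<close> with tails \<open>t\<close> of size \<open>r ^ (N - k)\<close>, a convolution of
  a null sequence with a geometric one, which tends to zero.
\<close>

lemma triangular_sum_swap: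
  fixes w :: "nat \<Rightarrow> nat \<Rightarrow> complex" and A :: "nat \<Rightarrow> complex"
  assumes r: "0 \<le> r" "r < 1"
    and bound: "\<And>m k. norm (w m k) \<le> C * r ^ m"
    and null: "A \<longlonglongrightarrow> 0"
    and summable_rows: "summable (\<lambda>k. A k * (\<Sum>m. w m k))"
  shows "(\<lambda>n. \<Sum>k\<le>n. w (n - k) k * A k) sums (\<Sum>k. A k * (\<Sum>m. w m k))"
proof -
  have geo: "summable (\<lambda>m. C * r ^ m)"
    using r by (intro summable_mult summable_geometric) auto
  have w_summable: "summable (\<lambda>m. w m k)" for k
    by (rule summable_comparison_test'[OF geo]) (use bound in auto)
  define t where "t l k = (\<Sum>m. w (m + l) k)" for l k
  have t_eq: "t l k = (\<Sum>m. w m k) - (\<Sum>m<l. w m k)" for l k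
    unfolding t_def by (rule suminf_minus_initial_segment[OF w_summable])
  have t_bound: "norm (t l k) \<le> C / (1 - r) * r ^ l" for l k
  proof -
    have "norm (t l k) \<le> (\<Sum>m. C * r ^ l * r ^ m)"
      unfolding t_def
    proof (rule norm_suminf_le)
      show "norm (w (m + l) k) \<le> C * r ^ l * r ^ m" for m
        using bound[of "m + l" k] by (simp add: power_add mult_ac)
      show "summable (\<lambda>m. C * r ^ l * r ^ m)"
        using r by (intro summable_mult summable_geometric) auto
    qed
    also have "\<dots> = C / (1 - r) * r ^ l"
      using r by (subst suminf_mult) (auto simp: suminf_geometric summable_geometric)
    finally show ?thesis .
  qed
  have partial: "(\<Sum>n<N. \<Sum>k\<le>n. w (n - k) k * A k) = (\<Sum>k<N. A k * (\<Sum>m<N - k. w m k))" for N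
  proof (induction N)
    case (Suc N)
    have "(\<Sum>k<Suc N. A k * (\<Sum>m<Suc N - k. w m k))
        = (\<Sum>k<Suc N. A k * (\<Sum>m<N - k. w m k) + w (N - k) k * A k)"
      by (intro sum.cong) (auto simp: Suc_diff_le algebra_simps)
    also have "\<dots> = (\<Sum>k<N. A k * (\<Sum>m<N - k. w m k)) + (\<Sum>k\<le>N. w (N - k) k * A k)"
      by (simp add: sum.distrib lessThan_Suc_atMost[symmetric])
    finally show ?case
      using Suc by simp
  qed simp
  have diff: "(\<Sum>n<N. \<Sum>k\<le>n. w (n - k) k * A k)
      = (\<Sum>k<N. A k * (\<Sum>m. w m k)) - (\<Sum>k<N. A k * t (N - k) k)" for N
    unfolding partial by (simp add: t_eq algebra_simps sum_subtractf)
  obtain B where B: "B > 0" "\<And>k. norm (A k) \<le> B"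
    using null by (meson BseqE convergentI convergent_imp_Bseq)
  have "(\<lambda>N. \<Sum>k<N. A k * t (N - k) k) \<longlonglongrightarrow> 0"
  proof -
    \<comment> \<open>Indexing by the distance \<open>j = N - Suc k\<close> turns the sum into one dominated by a fixed
        geometric series and null in each term.\<close>
    define g where "g j N = (if j < N then A (N - Suc j) * t (Suc j) (N - Suc j) else 0)" for j N
    have sum_g: "(\<Sum>k<N. A k * t (N - k) k) = (\<Sum>j. g j N)" for N
    proof -
      have "(\<Sum>k<N. A k * t (N - k) k) = (\<Sum>j<N. A (N - Suc j) * t (N - (N - Suc j)) (N - Suc j))"
        by (rule sum.nat_diff_reindex[symmetric])
      also have "\<dots> = (\<Sum>j<N. g j N)"
        by (intro sum.cong) (auto simp: g_def Suc_diff_Suc)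
      also have "\<dots> = (\<Sum>j. g j N)"
        by (rule suminf_finite[symmetric]) (auto simp: g_def)
      finally show ?thesis .
    qed
    have g_bound: "norm (g j N) \<le> B * (C / (1 - r) * r ^ Suc j)" for j N
    proof -
      have nonneg: "0 \<le> C / (1 - r) * r ^ Suc j"
        using t_bound[of "Suc j" 0] norm_ge_zero order_trans by blast
      show ?thesis
      proof (cases "j < N")
        case True
        have "norm (A (N - Suc j)) * norm (t (Suc j) (N - Suc j)) \<le> B * (C / (1 - r) * r ^ Suc j)"
          by (rule mult_mono[OF B(2) t_bound less_imp_le[OF B(1)] norm_ge_zero])
        with True show ?thesis
          unfolding g_def by (simp only: if_True norm_mult)
      qed (use mult_nonneg_nonneg[OF less_imp_le[OF B(1)] nonneg] in \<open>simp only: g_def if_False norm_zero\<close>)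
    qed
    have g_null: "(\<lambda>N. g j N) \<longlonglongrightarrow> 0" for j
    proof (rule Lim_null_comparison)
      have "(\<lambda>N. norm (A N)) \<longlonglongrightarrow> 0"
        using null by (rule tendsto_norm_zero)
      then have "(\<lambda>N. norm (A (N - Suc j))) \<longlonglongrightarrow> 0"
        by (intro LIMSEQ_offset[where k = "Suc j" and f = "\<lambda>N. norm (A (N - Suc j))"]) simp
      then show "(\<lambda>N. norm (A (N - Suc j)) * (C / (1 - r) * r ^ Suc j)) \<longlonglongrightarrow> 0"
        by (rule tendsto_mult_left_zero)
      show "eventually (\<lambda>N. norm (g j N) \<le> norm (A (N - Suc j)) * (C / (1 - r) * r ^ Suc j)) sequentially"
        using eventually_gt_at_top[of j]
        by eventually_elim (simp only: g_def if_True norm_mult mult_left_mono[OF t_bound norm_ge_zero])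
    qed
    have "summable (\<lambda>j. B * (C / (1 - r) * r ^ Suc j))"
      using r by (intro summable_mult) (auto simp: summable_Suc_iff summable_geometric)
    then have "(\<lambda>N. \<Sum>j. g j N) \<longlonglongrightarrow> (\<Sum>j. 0)"
      by (intro tannerys_theorem[where M = "\<lambda>j. B * (C / (1 - r) * r ^ Suc j)",
            THEN conjunct2, THEN conjunct2, OF g_null])
         (use g_bound in \<open>auto simp del: power_Suc intro!: always_eventually\<close>)
    then show ?thesis
      by (simp add: sum_g)
  qed
  from tendsto_diff[OF summable_LIMSEQ[OF summable_rows] this]
  show ?thesis
    by (simp add: sums_def diff)
qed

section \<open>The triangular kernel of the transformation\<close>

text \<open>
  The weight of \<open>q ^ k * \<alpha> k\<close> in the term of the \<open>\<beta>\<close>-series with index \<open>n = m + k\<close>. The power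
  \<open>q ^ k\<close> is split off and \<open>m\<close> is used in place of \<open>n\<close> so that the decay in \<open>m\<close> is uniform in \<open>k\<close>.
\<close>

definition bailey_kernel :: "complex \<Rightarrow> complex \<Rightarrow> complex \<Rightarrow> nat \<Rightarrow> nat \<Rightarrow> complex" where
  "bailey_kernel q a b m k =
     qprod (a * b) q (2 * (m + k)) * q ^ m /
     (qprod (a * q) q (m + k) * qprod (b * q) q (m + k) * qprod q q m * qprod (a * b) q (m + 2 * k))"

context
  fixes q a b :: complex
  assumes q_nz: "q \<noteq> 0" and q_lt: "norm q < 1"
    and nz_a: "\<And>k. a * q * q ^ k \<noteq> 1"
    and nz_b: "\<And>k. b * q * q ^ k \<noteq> 1"
    and nz_ab: "\<And>k. a * b * q ^ k \<noteq> 1"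
begin

lemma kernel_bound:
  obtains C where "\<And>m k. norm (bailey_kernel q a b m k) \<le> C * norm q ^ m"
proof -
  obtain Ba where Ba: "Ba > 0" "\<And>n. norm (inverse (qprod (a * q) q n)) \<le> Ba"
    using qprod_bounded[of q "a * q", OF q_lt nz_a] by metis
  obtain Bb where Bb: "Bb > 0" "\<And>n. norm (inverse (qprod (b * q) q n)) \<le> Bb"
    using qprod_bounded[of q "b * q", OF q_lt nz_b] by metis
  obtain Bq where Bq: "Bq > 0" "\<And>n. norm (inverse (qprod q q n)) \<le> Bq"
    using qprod_bounded[of q q, OF q_lt power_neq_1[OF q_lt]] by metis
  obtain Bc where Bc: "Bc > 0" "\<And>n. norm (qprod (a * b) q n) \<le> Bc"
      "\<And>n. norm (inverse (qprod (a * b) q n)) \<le> Bc"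
    using qprod_bounded[of q "a * b", OF q_lt nz_ab] by metis
  show ?thesis
  proof
    fix m k
    have "norm (bailey_kernel q a b m k) =
        norm (qprod (a * b) q (2 * (m + k))) * norm (inverse (qprod (a * q) q (m + k)))
        * norm (inverse (qprod (b * q) q (m + k))) * norm (inverse (qprod q q m))
        * norm (inverse (qprod (a * b) q (m + 2 * k))) * norm q ^ m"
      by (simp add: bailey_kernel_def norm_mult norm_divide norm_power norm_inverse field_simps)
    also have "\<dots> \<le> Bc * Ba * Bb * Bq * Bc * norm q ^ m"
      by (intro mult_mono Ba Bb Bq Bc order_refl mult_nonneg_nonneg norm_ge_zero zero_le_power
          less_imp_le[OF Ba(1)] less_imp_le[OF Bb(1)] less_imp_le[OF Bq(1)] less_imp_le[OF Bc(1)])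
    finally show "norm (bailey_kernel q a b m k) \<le> Bc * Ba * Bb * Bq * Bc * norm q ^ m" .
  qed
qed

lemma summable_kernel: "summable (\<lambda>m. bailey_kernel q a b m k)"
proof -
  obtain C where C: "\<And>m k. norm (bailey_kernel q a b m k) \<le> C * norm q ^ m"
    by (rule kernel_bound) blast
  have "summable (\<lambda>m. C * norm q ^ m)"
    using q_lt by (intro summable_mult summable_geometric) auto
  then show ?thesis
    by (rule summable_comparison_test') (use C in auto)
qed

text \<open>
  Splitting \<open>(aq; q)\<^bsub>m+k\<^esub>\<close> and \<open>(bq; q)\<^bsub>m+k\<^esub>\<close> at \<open>k\<close> leaves a factor \<open>(aq, bq; q)\<^sub>k\<close>, which is exactly
  what separates the infinite products at \<open>aq, bq\<close> from those at \<open>a q^(k+1), b q^(k+1)\<close>; the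
  factor \<open>(ab; q)\<^bsub>2k\<^esub>\<close> cancels.
\<close>

lemma L_eq_kernel_sum:
  "L q (a * q ^ (k + 1)) (b * q ^ (k + 1)) = qpochs_inf [q, a * q, b * q] q * (\<Sum>m. bailey_kernel q a b m k)"
proof -
  define c where "c = qprod (a * q) q k * qprod (b * q) q k"
  have term_eq: "L_term q (a * q ^ (k + 1)) (b * q ^ (k + 1)) m = c * bailey_kernel q a b m k" for m
  proof -
    have xy: "a * q ^ (k + 1) * (b * q ^ (k + 1)) / q\<^sup>2 = a * b * q ^ (2 * k)"
      using q_nz by (simp add: field_simps power2_eq_square power_mult power_mult_distrib)
    have x: "a * q ^ (k + 1) = a * q * q ^ k" and y: "b * q ^ (k + 1) = b * q * q ^ k"
      by simp_all
    have nz: "a * q * q ^ k * q ^ i \<noteq> 1" "b * q * q ^ k * q ^ i \<noteq> 1"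
        "a * b * q ^ (2 * k) * q ^ i \<noteq> 1" for i
      using nz_a[of "k + i"] nz_b[of "k + i"] nz_ab[of "2 * k + i"]
      by (simp_all add: power_add mult.assoc)
    have qpoch_2m: "qpoch (a * b * q ^ (2 * k)) q (2 * int m) = qprod (a * b * q ^ (2 * k)) q (2 * m)"
      using qpoch_eq_qprod[of q "a * b * q ^ (2 * k)" "2 * m", OF q_lt nz(3)] by simp
    have qpoch_m: "qpoch q q (int m) = qprod q q m"
      "qpoch (a * q * q ^ k) q (int m) = qprod (a * q * q ^ k) q m"
      "qpoch (b * q * q ^ k) q (int m) = qprod (b * q * q ^ k) q m"
      "qpoch (a * b * q ^ (2 * k)) q (int m) = qprod (a * b * q ^ (2 * k)) q m"
      by (intro qpoch_eq_qprod q_lt nz power_neq_1)+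
    have split: "qprod (a * q) q (m + k) = qprod (a * q) q k * qprod (a * q * q ^ k) q m"
      "qprod (b * q) q (m + k) = qprod (b * q) q k * qprod (b * q * q ^ k) q m"
      "qprod (a * b) q (m + 2 * k) = qprod (a * b) q (2 * k) * qprod (a * b * q ^ (2 * k)) q m"
      "qprod (a * b) q (2 * (m + k)) = qprod (a * b) q (2 * k) * qprod (a * b * q ^ (2 * k)) q (2 * m)"
      using qprod_add[of "a * q" q k m] qprod_add[of "b * q" q k m]
        qprod_add[of "a * b" q "2 * k" m] qprod_add[of "a * b" q "2 * k" "2 * m"]
      by (simp_all add: algebra_simps)
    have c: "qprod (a * q) q k \<noteq> 0" "qprod (b * q) q k \<noteq> 0" "qprod (a * b) q (2 * k) \<noteq> 0"
      using qprod_nonzero[of "a * q" q, OF nz_a] qprod_nonzero[of "b * q" q, OF nz_b]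
        qprod_nonzero[of "a * b" q, OF nz_ab] by auto
    show ?thesis
      unfolding L_term_def xy unfolding x y qpoch_2m bailey_kernel_def c_def split qpochs_def
      using c by (simp add: qpoch_m)
  qed
  have "(\<Sum>m. L_term q (a * q ^ (k + 1)) (b * q ^ (k + 1)) m) = c * (\<Sum>m. bailey_kernel q a b m k)"
    unfolding term_eq by (rule suminf_mult[OF summable_kernel])
  moreover have "qpochs_inf [q, a * q, b * q] q = qpochs_inf [q, a * q ^ (k + 1), b * q ^ (k + 1)] q * c"
    using qpoch_inf_split[OF q_lt, of "a * q" k] qpoch_inf_split[OF q_lt, of "b * q" k]
    by (simp add: qpochs_inf_def c_def mult_ac)
  ultimately show ?thesis
    by (simp only: L_def mult_ac)
qed

text \<open>
  As \<open>k\<close> grows, all factors of the kernel that involve \<open>a\<close> or \<open>b\<close> tend to infinite products, and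
  what remains is Euler's series. That the limit is not zero is what matters: it allows one to
  recover \<open>q ^ k * \<alpha> k \<longlonglongrightarrow> 0\<close> from the convergence of the series with terms \<open>L * q ^ k * \<alpha> k\<close>.
\<close>

lemma L_tendsto_1: "(\<lambda>k. L q (a * q ^ (k + 1)) (b * q ^ (k + 1))) \<longlonglongrightarrow> 1"
proof -
  obtain C where C: "\<And>m k. norm (bailey_kernel q a b m k) \<le> C * norm q ^ m"
    by (rule kernel_bound) blast
  define D where "D = qpoch_inf (a * q) q * qpoch_inf (b * q) q"
  have inf_nz: "qpoch_inf (a * q) q \<noteq> 0" "qpoch_inf (b * q) q \<noteq> 0" "qpoch_inf (a * b) q \<noteq> 0"
      "qpoch_inf q q \<noteq> 0"
    by (intro qpoch_inf_nonzero q_lt nz_a nz_b nz_ab power_neq_1)+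
  have qnz: "qprod q q m \<noteq> 0" for m
    using power_neq_1[OF q_lt] by (rule qprod_nonzero)
  have shifted: "(\<lambda>k. qprod x q (f k)) \<longlonglongrightarrow> qpoch_inf x q" if "\<And>k. k \<le> f k" for x f
    using that by (intro filterlim_compose[OF qprod_tendsto[OF q_lt]] filterlim_at_top_mono[OF filterlim_ident]) auto
  have limit: "(\<lambda>k. bailey_kernel q a b m k) \<longlonglongrightarrow> q ^ m / qprod q q m / D" for m
  proof -
    have "(\<lambda>k. bailey_kernel q a b m k) \<longlonglongrightarrow> qpoch_inf (a * b) q * q ^ m /
       (qpoch_inf (a * q) q * qpoch_inf (b * q) q * qprod q q m * qpoch_inf (a * b) q)"
      unfolding bailey_kernel_def
      by (intro tendsto_intros shifted) (use inf_nz qnz in auto)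
    then show ?thesis
      using inf_nz by (simp add: D_def mult_ac)
  qed
  have "summable (\<lambda>m. C * norm q ^ m)"
    using q_lt by (intro summable_mult summable_geometric) auto
  then have "(\<lambda>k. \<Sum>m. bailey_kernel q a b m k) \<longlonglongrightarrow> (\<Sum>m. q ^ m / qprod q q m / D)"
    by (intro tannerys_theorem[where M = "\<lambda>m. C * norm q ^ m", THEN conjunct2, THEN conjunct2, OF limit])
       (use C in \<open>auto intro!: always_eventually\<close>)
  also have "(\<Sum>m. q ^ m / qprod q q m / D) = 1 / qpoch_inf q q / D"
    using sums_divide[OF euler_sum[OF q_lt]] by (rule sums_unique[symmetric])
  finally have "(\<lambda>k. qpochs_inf [q, a * q, b * q] q * (\<Sum>m. bailey_kernel q a b m k))
      \<longlonglongrightarrow> qpochs_inf [q, a * q, b * q] q * (1 / qpoch_inf q q / D)"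
    by (rule tendsto_mult_left)
  also have "qpochs_inf [q, a * q, b * q] q * (1 / qpoch_inf q q / D) = 1"
    using inf_nz by (simp add: qpochs_inf_def D_def)
  finally show ?thesis
    by (simp only: L_eq_kernel_sum)
qed

lemma bailey_term_eq_kernel_sum:
  assumes "bailey_pair q (a * b / q) \<alpha> \<beta>"
  shows "qpoch (a * b) q (2 * int n) / qpochs [a * q, b * q] q (int n) * q ^ n * \<beta> n
       = (\<Sum>k\<le>n. bailey_kernel q a b (n - k) k * (q ^ k * \<alpha> k))"
proof -
  have poch_2n: "qpoch (a * b) q (2 * int n) = qprod (a * b) q (2 * n)"
    using qpoch_eq_qprod[of q "a * b" "2 * n", OF q_lt nz_ab] by simp
  have "\<beta> n = (\<Sum>k\<le>n. \<alpha> k / (qprod q q (n - k) * qprod (a * b) q (n + k)))"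
  proof -
    have "qpoch q q (int n - int k) * qpoch (a * b) q (int n + int k)
        = qprod q q (n - k) * qprod (a * b) q (n + k)" if "k \<le> n" for k
      using that qpoch_eq_qprod[of q q "n - k", OF q_lt power_neq_1[OF q_lt]]
        qpoch_eq_qprod[of q "a * b" "n + k", OF q_lt nz_ab]
      by (simp add: of_nat_diff)
    then show ?thesis
      using assms q_nz by (simp add: bailey_pair_def atLeast0AtMost)
  qed
  then have "qpoch (a * b) q (2 * int n) / qpochs [a * q, b * q] q (int n) * q ^ n * \<beta> n
      = (\<Sum>k\<le>n. qprod (a * b) q (2 * n) / (qprod (a * q) q n * qprod (b * q) q n) * q ^ n
           * (\<alpha> k / (qprod q q (n - k) * qprod (a * b) q (n + k))))"
    by (simp add: poch_2n qpochs_def qpoch_eq_qprod q_lt nz_a nz_b sum_distrib_left)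
  also have "\<dots> = (\<Sum>k\<le>n. bailey_kernel q a b (n - k) k * (q ^ k * \<alpha> k))"
  proof (intro sum.cong refl)
    fix k assume "k \<in> {..n}"
    then have "n - k + k = n" "n - k + 2 * k = n + k" "q ^ n = q ^ (n - k) * q ^ k"
      by (auto simp: power_add[symmetric])
    then show "qprod (a * b) q (2 * n) / (qprod (a * q) q n * qprod (b * q) q n) * q ^ n
           * (\<alpha> k / (qprod q q (n - k) * qprod (a * b) q (n + k)))
         = bailey_kernel q a b (n - k) k * (q ^ k * \<alpha> k)"
      by (simp add: bailey_kernel_def mult_ac add.commute)
  qed
  finally show ?thesis .
qed

end

section \<open>The transformation\<close>

theorem theorem1p9:
  fixes q a b :: complex and \<alpha> \<beta> :: "nat \<Rightarrow> complex"
  assumes q: "0 < norm q" "norm q < 1"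
    and nz_a: "\<And>k::nat. a * q ^ (k + 1) \<noteq> 1"
    and nz_b: "\<And>k::nat. b * q ^ (k + 1) \<noteq> 1"
    and nz_ab: "\<And>k::nat. a * b * q ^ k \<noteq> 1"
    and bailey: "bailey_pair q (a * b / q) \<alpha> \<beta>"
    and conv_L: "\<And>n::nat. summable (L_term q (a * q ^ (n + 1)) (b * q ^ (n + 1)))"
    and conv_lhs: "summable (\<lambda>n. L q (a * q ^ (n + 1)) (b * q ^ (n + 1)) * q ^ n * \<alpha> n)"
    and conv_rhs: "summable (\<lambda>n. qpoch (a * b) q (2 * int n) / qpochs [a * q, b * q] q (int n) * q ^ n * \<beta> n)"
  shows "(\<Sum>n. L q (a * q ^ (n + 1)) (b * q ^ (n + 1)) * q ^ n * \<alpha> n) =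
         qpochs_inf [q, a * q, b * q] q *
         (\<Sum>n. qpoch (a * b) q (2 * int n) / qpochs [a * q, b * q] q (int n) * q ^ n * \<beta> n)"
proof -
  have q_nz: "q \<noteq> 0"
    using q(1) by auto
  have na: "a * q * q ^ k \<noteq> 1" and nb: "b * q * q ^ k \<noteq> 1" for k
    using nz_a[of k] nz_b[of k] by (simp_all add: mult_ac)
  note ctxt = q_nz q(2) na nb nz_ab
  define P where "P = qpochs_inf [q, a * q, b * q] q"
  define A where "A k = q ^ k * \<alpha> k" for k
  let ?L = "\<lambda>k. L q (a * q ^ (k + 1)) (b * q ^ (k + 1))"
  have L_eq: "?L k = P * (\<Sum>m. bailey_kernel q a b m k)" for k
    unfolding P_def by (rule L_eq_kernel_sum[OF ctxt])
  have LA: "?L k * q ^ k * \<alpha> k = ?L k * A k" for k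
    by (simp add: A_def)
  have P_nz: "P \<noteq> 0"
    using qpoch_inf_nonzero[OF q(2) na] qpoch_inf_nonzero[OF q(2) nb]
      qpoch_inf_nonzero[OF q(2) power_neq_1[OF q(2)]]
    by (simp add: P_def qpochs_inf_def)
  have "A \<longlonglongrightarrow> 0"
  proof -
    have lim: "?L \<longlonglongrightarrow> 1"
      by (rule L_tendsto_1[OF ctxt])
    have "(\<lambda>k. ?L k * A k) \<longlonglongrightarrow> 0"
      using summable_LIMSEQ_zero[OF conv_lhs] by (simp only: LA)
    then have "(\<lambda>k. ?L k * A k / ?L k) \<longlonglongrightarrow> 0"
      using tendsto_divide[OF _ lim] by fastforce
    moreover have "eventually (\<lambda>k. ?L k * A k / ?L k = A k) sequentially"
      using tendsto_imp_eventually_ne[OF lim one_neq_zero] by eventually_elim auto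
    ultimately show ?thesis
      by (rule Lim_transform_eventually)
  qed
  have rows: "summable (\<lambda>k. A k * (\<Sum>m. bailey_kernel q a b m k))"
  proof -
    have "summable (\<lambda>k. P * (A k * (\<Sum>m. bailey_kernel q a b m k)))"
      using conv_lhs unfolding LA unfolding L_eq by (simp only: mult_ac)
    then show ?thesis
      using P_nz by (simp add: summable_cmult_iff)
  qed
  obtain C where C: "\<And>m k. norm (bailey_kernel q a b m k) \<le> C * norm q ^ m"
    by (rule kernel_bound[OF ctxt]) blast
  have "(\<lambda>n. \<Sum>k\<le>n. bailey_kernel q a b (n - k) k * A k) sums (\<Sum>k. A k * (\<Sum>m. bailey_kernel q a b m k))"
    by (rule triangular_sum_swap[OF norm_ge_zero q(2) C \<open>A \<longlonglongrightarrow> 0\<close> rows])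
  then have "(\<Sum>n. qpoch (a * b) q (2 * int n) / qpochs [a * q, b * q] q (int n) * q ^ n * \<beta> n)
      = (\<Sum>k. A k * (\<Sum>m. bailey_kernel q a b m k))"
    unfolding bailey_term_eq_kernel_sum[OF ctxt bailey] A_def by (rule sums_unique[symmetric])
  moreover have "(\<Sum>k. ?L k * q ^ k * \<alpha> k) = P * (\<Sum>k. A k * (\<Sum>m. bailey_kernel q a b m k))"
    unfolding LA unfolding L_eq suminf_mult[OF rows, symmetric] by (simp only: mult_ac)
  ultimately show ?thesis
    by (simp add: P_def)
qed

end
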